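(* Let $k\ge 0$ be an integer and $\underline{s}\in S^{q-1}$. For $(\underline{x},\underline{y})\in\mathbb{R}^p\times\mathbb{R}^q$ the function $$B=\int_{S^{p-1}} (\langle \underline{x},\underline{t}\rangle+i\langle\underline{y},\underline{s}\rangle)^k\,dS(\underline{t})$$ is of the form $$B=\lambda_{p-1}\sum_{j=0}^{[\frac{k}{2}]} \underline{x}^{2j}b_j(\langle\underline{y},\underline{s}\rangle),$$ where $$b_j(\langle\underline{y},\underline{s}\rangle)=(-1)^j\binom{k}{2j}\frac{\Gamma(\frac{p-1}{2})\Gamma(j+\frac{1}{2})}{\Gamma(\frac{p}{2}+j)}(i\langle\underline{y},\underline{s}\rangle)^{k-2j}$$ and $\lambda_{p-1}$ is the measure of the unit sphere $S^{p-1}$ of $\mathbb{R}^p$.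
   Context: $\mathbb{C}_{p+q}$ is the complex Clifford algebra with generators $e_1,\dots,e_{p+q}$ satisfying $e_ie_j+e_je_i=-2\delta_{ij}$. Vectors $\underline{x},\underline{t}\in\mathbb{R}^p$ are embedded as $\sum_{j=1}^p x_je_j$, $\sum_{j=1}^p t_je_j$, and $\underline{y},\underline{s}\in\mathbb{R}^q$ as $\sum_{j=1}^q y_je_{p+j}$, $\sum_{j=1}^q s_je_{p+j}$; powers $\underline{x}^n$ are Clifford powers. $i$ is the (central) imaginary unit, $\langle\cdot,\cdot\rangle$ the Euclidean inner product, $S^{m-1}$ the unit sphere of $\mathbb{R}^m$, $dS$ its scalar surface element, and $\Gamma$ the Gamma function. $[\cdot]$ denotes the integer part (floor).
   Formalization: The constant λ_{p-1} is taken as the measure of the unit sphere S^{p-2} of R^{p-1}, not of S^{p-1} in R^p, since the printed reading already fails for k=0 (for p=2 by a factor π); and p ≥ 2 is assumed so that Γ((p-1)/2) is defined. *)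

theory Defs
  imports "HOL-Analysis.Analysis"
begin

section \<open>Ordered index sets for the generators\<close>

text \<open>
  The generators of \<open>\<complex>\<^sub>p\<^sub>+\<^sub>q\<close> are indexed by \<open>'p + 'q\<close>, where \<open>'p\<close> and \<open>'q\<close> are finite linear orders
  with \<open>p\<close> and \<open>q\<close> elements: \<open>e\<^sub>j\<close> is \<open>Inl j\<close> and \<open>e\<^sub>p\<^sub>+\<^sub>j\<close> is \<open>Inr j\<close>.
\<close>

instantiation sum :: (linorder, linorder) linorder
begin

definition less_eq_sum :: "'a + 'b \<Rightarrow> 'a + 'b \<Rightarrow> bool" where
  "less_eq_sum u v = (case u of
      Inl a \<Rightarrow> (case v of Inl a' \<Rightarrow> a \<le> a' | Inr _ \<Rightarrow> True)
    | Inr b \<Rightarrow> (case v of Inl _ \<Rightarrow> False | Inr b' \<Rightarrow> b \<le> b'))"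

definition less_sum :: "'a + 'b \<Rightarrow> 'a + 'b \<Rightarrow> bool" where
  "less_sum u v \<longleftrightarrow> u \<le> v \<and> \<not> v \<le> u"

instance
  by standard (auto simp: less_eq_sum_def less_sum_def split: sum.splits)

end


section \<open>The complex Clifford algebra\<close>

text \<open>
  An element is given by its coefficients with respect to the basis
  \<open>e\<^sub>A = e\<^sub>i\<^sub>1 \<cdots> e\<^sub>i\<^sub>k\<close>, where \<open>A = {i\<^sub>1 < \<dots> < i\<^sub>k}\<close> ranges over the subsets of the index set.
\<close>

typedef 'n clifford = "UNIV :: ('n set \<Rightarrow> complex) set"
  morphisms coeff Clifford
  by simp

declare coeff_inverse [simp] Clifford_inverse [OF UNIV_I, simp]

lemma clifford_eqI: "(\<And>A. coeff a A = coeff b A) \<Longrightarrow> a = b"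
  by (metis coeff_inverse ext)

text \<open>
  \<open>e\<^sub>A e\<^sub>B = blade_sign A B \<cdot> e\<^sub>A\<^sub>\<Delta>\<^sub>B\<close>: sorting \<open>e\<^sub>A e\<^sub>B\<close> takes one transposition for each pair
  \<open>i \<in> A\<close>, \<open>j \<in> B\<close> with \<open>j < i\<close>, and each pair with \<open>j = i\<close> contributes \<open>e\<^sub>i\<^sup>2 = -1\<close>.
\<close>

definition blade_sign :: "'n::linorder set \<Rightarrow> 'n set \<Rightarrow> complex" where
  "blade_sign A B = (\<Prod>i\<in>A. \<Prod>j\<in>B. if j \<le> i then - 1 else 1)"

lemma prod_sym_diff:
  fixes f :: "'n::finite \<Rightarrow> complex"
  assumes "\<And>i. f i * f i = 1"
  shows "prod f (sym_diff A B) = prod f A * prod f B"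
proof -
  have 1: "prod f (A \<inter> B) * prod f (A \<inter> B) = 1"
    by (simp add: prod.distrib [symmetric] assms)
  have "prod f A = prod f (A - B) * prod f (A \<inter> B)"
    by (subst prod.union_disjoint [symmetric]) (auto intro: arg_cong [where f = "prod f"])
  moreover have "prod f B = prod f (B - A) * prod f (A \<inter> B)"
    by (subst prod.union_disjoint [symmetric]) (auto intro: arg_cong [where f = "prod f"])
  moreover have "prod f (sym_diff A B) = prod f (A - B) * prod f (B - A)"
    by (rule prod.union_disjoint) auto
  ultimately have "prod f A * prod f B
      = prod f (sym_diff A B) * (prod f (A \<inter> B) * prod f (A \<inter> B))"
    by (simp only: mult_ac)
  with 1 show ?thesis by simp
qed

lemma blade_sign_sym_diff_right:
  fixes A B C :: "'n::{finite,linorder} set"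
  shows "blade_sign A (sym_diff B C) = blade_sign A B * blade_sign A C"
  unfolding blade_sign_def by (subst prod_sym_diff) (auto simp: prod.distrib)

lemma blade_sign_sym_diff_left:
  fixes A B C :: "'n::{finite,linorder} set"
  shows "blade_sign (sym_diff A B) C = blade_sign A C * blade_sign B C"
  unfolding blade_sign_def
  by (rule prod_sym_diff) (auto simp: prod.distrib [symmetric] intro!: prod.neutral)

lemma blade_sign_empty [simp]: "blade_sign {} B = 1" "blade_sign A {} = 1"
  by (simp_all add: blade_sign_def)

instantiation clifford :: (type) ab_group_add
begin

definition "0 = Clifford (\<lambda>A. 0)"
definition "a + b = Clifford (\<lambda>A. coeff a A + coeff b A)"
definition "- a = Clifford (\<lambda>A. - coeff a A)"
definition "a - b = Clifford (\<lambda>A. coeff a A - coeff b A)" for a b :: "'a clifford"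

instance
  by standard (auto intro!: clifford_eqI
      simp: zero_clifford_def plus_clifford_def uminus_clifford_def minus_clifford_def)

end

lemma coeff_add_group [simp]:
  "coeff 0 A = 0" "coeff (a + b) A = coeff a A + coeff b A"
  "coeff (- a) A = - coeff a A" "coeff (a - b) A = coeff a A - coeff b A"
  by (simp_all add: zero_clifford_def plus_clifford_def uminus_clifford_def minus_clifford_def)

lemma coeff_sum [simp]: "coeff (sum f I) A = (\<Sum>i\<in>I. coeff (f i) A)"
  by (induction I rule: infinite_finite_induct) auto

definition clifford_of_complex :: "complex \<Rightarrow> 'n clifford" where
  "clifford_of_complex c = Clifford (\<lambda>A. if A = {} then c else 0)"

lemma coeff_clifford_of_complex [simp]:
  "coeff (clifford_of_complex c) A = (if A = {} then c else 0)"
  by (simp add: clifford_of_complex_def)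

instantiation clifford :: ("{finite,linorder}") ring_1
begin

definition "1 = clifford_of_complex 1"
definition "a * b = Clifford (\<lambda>C. \<Sum>A\<in>UNIV.
    blade_sign A (sym_diff A C) * coeff a A * coeff b (sym_diff A C))"

instance
proof
  fix a b c :: "'a clifford"
  show "a * b * c = a * (b * c)"
  proof (rule clifford_eqI)
    fix D :: "'a set"
    have "coeff (a * b * c) D = (\<Sum>B\<in>UNIV. \<Sum>A\<in>UNIV. blade_sign B (sym_diff B D) *
        blade_sign A (sym_diff A B) * coeff a A * coeff b (sym_diff A B) * coeff c (sym_diff B D))"
      by (simp add: times_clifford_def sum_distrib_left sum_distrib_right mult_ac)
    also have "\<dots> = (\<Sum>A\<in>UNIV. \<Sum>B\<in>UNIV. blade_sign B (sym_diff B D) *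
        blade_sign A (sym_diff A B) * coeff a A * coeff b (sym_diff A B) * coeff c (sym_diff B D))"
      by (rule sum.swap)
    also have "\<dots> = (\<Sum>A\<in>UNIV. \<Sum>B\<in>UNIV. blade_sign A (sym_diff A D) *
        blade_sign B (sym_diff B (sym_diff A D)) * coeff a A * coeff b B *
        coeff c (sym_diff B (sym_diff A D)))"
    proof (rule sum.cong [OF refl])
      fix A :: "'a set"
      have inv: "sym_diff A (sym_diff A B) = B" for B by auto
      have assoc: "sym_diff (sym_diff A B) D = sym_diff B (sym_diff A D)" for B by auto
      have dec: "sym_diff B (sym_diff B (sym_diff A D)) = sym_diff A D" for B by auto
      have sgn: "blade_sign (sym_diff A B) (sym_diff B (sym_diff A D)) * blade_sign A B
          = blade_sign A (sym_diff A D) * blade_sign B (sym_diff B (sym_diff A D))" for B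
      proof -
        have "blade_sign (sym_diff A B) (sym_diff B (sym_diff A D)) * blade_sign A B
          = blade_sign A B * blade_sign A (sym_diff B (sym_diff A D)) *
            blade_sign B (sym_diff B (sym_diff A D))"
          by (simp only: blade_sign_sym_diff_left mult_ac)
        also have "blade_sign A B * blade_sign A (sym_diff B (sym_diff A D))
            = blade_sign A (sym_diff A D)"
          by (subst blade_sign_sym_diff_right [symmetric]) (simp only: dec)
        finally show ?thesis .
      qed
      show "(\<Sum>B\<in>UNIV. blade_sign B (sym_diff B D) *
          blade_sign A (sym_diff A B) * coeff a A * coeff b (sym_diff A B) * coeff c (sym_diff B D))
        = (\<Sum>B\<in>UNIV. blade_sign A (sym_diff A D) *
          blade_sign B (sym_diff B (sym_diff A D)) * coeff a A * coeff b B *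
          coeff c (sym_diff B (sym_diff A D)))"
      proof (rule sum.reindex_bij_witness [where i = "sym_diff A" and j = "sym_diff A"], goal_cases)
        case (5 B)
        show ?case
          using sgn [of "sym_diff A B"] assoc [of "sym_diff A B"] by (simp only: inv mult_ac)
      qed auto
    qed
    also have "\<dots> = coeff (a * (b * c)) D"
      by (simp add: times_clifford_def sum_distrib_left mult_ac)
    finally show "coeff (a * b * c) D = coeff (a * (b * c)) D" .
  qed
  have del: "sym_diff {} C = C" for C :: "'a set" by auto
  show "1 * a = a"
    by (rule clifford_eqI)
      (simp add: times_clifford_def one_clifford_def if_distrib [of "\<lambda>u. u * _"]
        if_distrib [of "\<lambda>u. _ * u"] cong: if_cong)
  show "a * 1 = a"
  proof (rule clifford_eqI)
    fix C :: "'a set"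
    have "(sym_diff A C = {}) = (A = C)" for A by auto
    then show "coeff (a * 1) C = coeff a C"
      by (simp add: times_clifford_def one_clifford_def if_distrib [of "\<lambda>u. _ * u"] cong: if_cong)
  qed
  show "(a + b) * c = a * c + b * c"
    by (rule clifford_eqI) (simp add: times_clifford_def sum.distrib algebra_simps)
  show "a * (b + c) = a * b + a * c"
    by (rule clifford_eqI) (simp add: times_clifford_def sum.distrib algebra_simps)
  have "coeff (0::'a clifford) {} \<noteq> coeff 1 {}"
    by (simp add: one_clifford_def)
  then show "(0::'a clifford) \<noteq> 1" by metis
qed

end

definition blade :: "'n set \<Rightarrow> 'n clifford" where
  "blade A = Clifford (\<lambda>B. if B = A then 1 else 0)"

definition gen :: "'n \<Rightarrow> 'n clifford" where
  "gen i = blade {i}"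

lemma coeff_clifford_of_complex_mult [simp]:
  fixes a :: "'n::{finite,linorder} clifford"
  shows "coeff (clifford_of_complex c * a) A = c * coeff a A"
  by (simp add: times_clifford_def if_distrib [of "\<lambda>u. u * _"]
        if_distrib [of "\<lambda>u. _ * u"] cong: if_cong)

lemma clifford_of_complex_central:
  fixes a :: "'n::{finite,linorder} clifford"
  shows "a * clifford_of_complex c = clifford_of_complex c * a"
proof (rule clifford_eqI)
  fix C :: "'n set"
  have "(sym_diff A C = {}) = (A = C)" for A by auto
  then show "coeff (a * clifford_of_complex c) C = coeff (clifford_of_complex c * a) C"
    by (simp add: if_distrib [of "\<lambda>u. _ * u"] cong: if_cong) 
       (simp add: times_clifford_def if_distrib [of "\<lambda>u. _ * u"] cong: if_cong)
qed

lemma clifford_of_complex_hom: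
  "clifford_of_complex 1 = (1 :: 'n::{finite,linorder} clifford)"
  "clifford_of_complex (c + d) = (clifford_of_complex c + clifford_of_complex d :: 'n clifford)"
  "clifford_of_complex (c * d) = (clifford_of_complex c * clifford_of_complex d :: 'n clifford)"
  by (auto intro!: clifford_eqI simp: one_clifford_def)

lemma blade_mult:
  fixes A B :: "'n::{finite,linorder} set"
  shows "blade A * blade B = clifford_of_complex (blade_sign A B) * blade (sym_diff A B)"
proof (rule clifford_eqI)
  fix C :: "'n set"
  have 1: "(sym_diff A C = B) = (C = sym_diff A B)" by auto
  have 2: "sym_diff A (sym_diff A B) = B" by auto
  have "coeff (blade A * blade B) C = (\<Sum>A'\<in>UNIV. if A' = A
      then blade_sign A (sym_diff A C) * (if sym_diff A C = B then 1 else 0) else 0)"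
    unfolding times_clifford_def blade_def Clifford_inverse [OF UNIV_I]
    by (rule sum.cong) auto
  also have "\<dots> = blade_sign A (sym_diff A C) * (if C = sym_diff A B then 1 else 0)"
    by (simp only: 1 sum.delta' sum.delta finite UNIV_I if_True)
  also have "\<dots> = coeff (clifford_of_complex (blade_sign A B) * blade (sym_diff A B)) C"
    unfolding coeff_clifford_of_complex_mult using 2 by (auto simp: blade_def)
  finally show "coeff (blade A * blade B) C
      = coeff (clifford_of_complex (blade_sign A B) * blade (sym_diff A B)) C" .
qed

lemma gen_anticommute:
  fixes i j :: "'n::{finite,linorder}"
  shows "gen i * gen j + gen j * gen i = (if i = j then - 2 else 0)"
proof (cases "i = j")
  case True
  have "coeff (gen i * gen i) A = coeff (- 1) A" for A
    by (simp add: gen_def blade_mult one_clifford_def) (simp add: blade_sign_def blade_def)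
  then have "gen i * gen i = - 1" by (rule clifford_eqI)
  with True show ?thesis by simp
next
  case False
  then have ij: "sym_diff {i} {j} = {i, j}" "sym_diff {j} {i} = {i, j}"
    and "blade_sign {j} {i} = - blade_sign {i} {j}"
    by (auto simp: blade_sign_def)
  then have "coeff (gen i * gen j + gen j * gen i) A = coeff 0 A" for A
    by (simp only: gen_def blade_mult coeff_add_group coeff_clifford_of_complex_mult) simp
  then have "gen i * gen j + gen j * gen i = 0" by (rule clifford_eqI)
  with False show ?thesis by simp
qed

lemma blade_insert_greater:
  fixes A :: "'n::{finite,linorder} set"
  assumes "\<And>j. j \<in> A \<Longrightarrow> j < i"
  shows "blade (insert i A) = blade A * gen i"
proof -
  have "i \<notin> A" using assms by blast
  then have "sym_diff A {i} = insert i A" by auto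
  moreover have "blade_sign A {i} = 1"
    using assms by (force simp: blade_sign_def intro!: prod.neutral)
  ultimately show ?thesis
    by (simp add: gen_def blade_mult clifford_of_complex_hom)
qed

definition clifford_vector :: "real ^ 'p::{finite,linorder} \<Rightarrow> ('p + 'q::{finite,linorder}) clifford"
  where "clifford_vector x = (\<Sum>j\<in>UNIV. clifford_of_complex (of_real (x $ j)) * gen (Inl j))"


section \<open>Surface measure of the unit sphere\<close>

text \<open>
  The surface measure of a Borel set \<open>A\<close> of unit vectors is
  the dimension times the volume of the cone \<open>{r t | t \<in> A, 0 < r \<le> 1}\<close>.
\<close>

definition sphere_measure :: "'a::euclidean_space measure" where
  "sphere_measure = scale_measure (of_nat DIM('a))
     (distr (restrict_space lborel (cball 0 1 - {0})) (restrict_space borel (sphere 0 1))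
        (\<lambda>x. x /\<^sub>R norm x))"

lemma space_sphere_measure [simp]: "space sphere_measure = sphere 0 1"
  by (simp add: sphere_measure_def space_restrict_space space_scale_measure)

lemma sets_sphere_measure [simp, measurable_cong]:
  "sets sphere_measure = sets (restrict_space borel (sphere 0 1))"
  by (simp add: sphere_measure_def)

lemma measurable_normalize:
  "(\<lambda>x. x /\<^sub>R norm x) \<in> restrict_space lborel (cball 0 1 - {0 :: 'a::euclidean_space})
     \<rightarrow>\<^sub>M restrict_space borel (sphere 0 1)"
  by (rule measurable_restrict_space2) (auto simp: space_restrict_space intro!: measurable_restrict_space1)

lemma emeasure_sphere_measure:
  fixes A :: "'a::euclidean_space set"
  assumes "A \<in> sets borel" "A \<subseteq> sphere 0 1"
  shows "emeasure sphere_measure A =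
    of_nat DIM('a) * emeasure lborel {r *\<^sub>R t | r t. t \<in> A \<and> 0 < r \<and> r \<le> 1}"
proof -
  have A: "A \<in> sets (restrict_space borel (sphere 0 1))"
    using assms by (auto simp: sets_restrict_space)
  have cone: "(\<lambda>x. x /\<^sub>R norm x) -` A \<inter> (cball 0 1 - {0}) = {r *\<^sub>R t | r t. t \<in> A \<and> 0 < r \<and> r \<le> 1}"
    (is "?L = ?R")
  proof
    show "?L \<subseteq> ?R"
    proof
      fix x assume x: "x \<in> ?L"
      then have "x = norm x *\<^sub>R (x /\<^sub>R norm x)" "0 < norm x" "norm x \<le> 1" "x /\<^sub>R norm x \<in> A"
        by auto
      then show "x \<in> ?R" by blast
    qed
    show "?R \<subseteq> ?L"
      using assms(2) by auto
  qed
  have "emeasure (distr (restrict_space lborel (cball 0 1 - {0})) (restrict_space borel (sphere 0 1))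
      (\<lambda>x. x /\<^sub>R norm x)) A
    = emeasure (restrict_space lborel (cball 0 1 - {0}))
      ((\<lambda>x. x /\<^sub>R norm x) -` A \<inter> (cball 0 1 - {0}))"
    by (subst emeasure_distr [OF measurable_normalize A]) (simp add: space_restrict_space)
  also have "\<dots> = emeasure lborel ((\<lambda>x. x /\<^sub>R norm x) -` A \<inter> (cball 0 1 - {0}))"
    by (rule emeasure_restrict_space) auto
  finally show ?thesis
    by (simp only: sphere_measure_def emeasure_scale_measure cone)
qed

lemma emeasure_sphere_measure_sphere:
  "emeasure sphere_measure (sphere 0 1 :: 'a::euclidean_space set)
     = ennreal (DIM('a) * unit_ball_vol DIM('a))"
proof -
  have "{r *\<^sub>R t | r t. t \<in> sphere 0 1 \<and> 0 < r \<and> r \<le> 1} = cball (0::'a) 1 - {0}" (is "?L = ?R")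
  proof
    show "?R \<subseteq> ?L"
    proof
      fix x :: 'a assume x: "x \<in> ?R"
      then have "x = norm x *\<^sub>R (x /\<^sub>R norm x)" "0 < norm x" "norm x \<le> 1" "x /\<^sub>R norm x \<in> sphere 0 1"
        by auto
      then show "x \<in> ?L" by blast
    qed
  qed auto
  then show ?thesis
    by (simp add: emeasure_sphere_measure emeasure_Diff emeasure_cball ennreal_mult ennreal_of_nat_eq_real_of_nat)
qed

text \<open>
  \<open>unit_sphere_area TYPE(real ^ 'n)\<close> is the total surface measure of the unit sphere of
  \<open>\<real>\<^sup>n\<close>.  The constant \<open>\<lambda>\<^sub>p\<^sub>-\<^sub>1\<close> is this number for \<open>n = p - 1\<close>, i.e. the area of
  \<open>S\<^sup>p\<^sup>-\<^sup>2\<close>: with the factor \<open>\<Gamma>((p-1)/2)\<close> in \<open>b\<^sub>j\<close>, the case \<open>k = 0\<close> of the expansion reads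
  \<open>area S\<^sup>p\<^sup>-\<^sup>1 = \<lambda>\<^sub>p\<^sub>-\<^sub>1 \<Gamma>((p-1)/2) \<surd>\<pi> / \<Gamma>(p/2)\<close>, which does not hold if \<open>\<lambda>\<^sub>p\<^sub>-\<^sub>1\<close> is
  read as the area of \<open>S\<^sup>p\<^sup>-\<^sup>1\<close>.
\<close>

definition unit_sphere_area :: "'a::euclidean_space itself \<Rightarrow> real" where
  "unit_sphere_area _ = measure (sphere_measure :: 'a measure) (sphere 0 1)"

lemma unit_sphere_area_eq:
  "unit_sphere_area TYPE('a::euclidean_space) = 2 * pi powr (DIM('a) / 2) / Gamma (DIM('a) / 2)"
proof -
  have "unit_sphere_area TYPE('a) = DIM('a) * unit_ball_vol DIM('a)"
    by (simp add: unit_sphere_area_def measure_def emeasure_sphere_measure_sphere)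
  also have "\<dots> = 2 * pi powr (DIM('a) / 2) / Gamma (DIM('a) / 2)"
  proof -
    have pos: "real DIM('a) / 2 > 0" by simp
    then have "real DIM('a) / 2 \<notin> \<int>\<^sub>\<le>\<^sub>0"
      using nonpos_Ints_nonpos not_le by blast
    then have "Gamma (real DIM('a) / 2 + 1) = real DIM('a) / 2 * Gamma (real DIM('a) / 2)"
      by (rule Gamma_plus1)
    then show ?thesis
      unfolding unit_ball_vol_def by (simp only:) simp
  qed
  finally show ?thesis .
qed


section \<open>The coefficient functions\<close>

text \<open>The factor \<open>\<Gamma>((p-1)/2)\<close> makes this meaningful only for \<open>p \<ge> 2\<close>.\<close>

definition b_coeff :: "nat \<Rightarrow> nat \<Rightarrow> nat \<Rightarrow> real \<Rightarrow> complex" where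
  "b_coeff p k j u = (- 1) ^ j * of_nat (k choose (2 * j)) *
     of_real (Gamma ((real p - 1) / 2) * Gamma (real j + 1 / 2) / Gamma (real p / 2 + real j)) *
     (\<i> * of_real u) ^ (k - 2 * j)"

end

theory Submission
  imports Defs "HOL-Probability.Distributions" "HOL-Complex_Analysis.Cauchy_Integral_Formula"
begin

text \<open>
  A vector squares to a scalar, \<open>x\<^sup>2 = - |x|\<^sup>2\<close> (\<open>clifford_vector_square\<close>), so both sides of the
  claim are complex numbers and the claim is one about the moments of the sphere.  Expanding the
  \<open>k\<close>-th power by the binomial theorem, the odd powers of \<open>\<langle>x, t\<rangle>\<close> integrate to zero because
  \<open>t \<mapsto> - t\<close> preserves the surface measure, and for the even powers one needs
  \<open>\<integral> \<langle>x, t\<rangle>\<^sup>2\<^sup>j dS(t) = 2 \<pi>\<^bsup>(p-1)/2\<^esup> \<Gamma>(j + 1/2) / \<Gamma>(p/2 + j) |x|\<^sup>2\<^sup>j\<close>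
  (\<open>integral_sphere_measure_even_power\<close>).  The factor \<open>2 \<pi>\<^bsup>(p-1)/2\<^esup>\<close> is the area of the unit
  sphere of \<open>\<real>\<^sup>p\<^sup>-\<^sup>1\<close> times \<open>\<Gamma>((p-1)/2)\<close>, which is how that area and that value of \<open>\<Gamma>\<close> enter the
  formula, and the sign \<open>(-1)\<^sup>j\<close> in \<open>b_coeff\<close> compensates the one in \<open>x\<^sup>2\<^sup>j = (-1)\<^sup>j |x|\<^sup>2\<^sup>j\<close>.

  The moments of the sphere are obtained from those of the Gaussian \<open>exp (- |u|\<^sup>2)\<close> on \<open>\<real>\<^sup>p\<close>.  In
  polar coordinates (\<open>nn_integral_polar\<close>) the Gaussian moment is the product of the moment of the
  sphere and the radial integral \<open>\<integral> r\<^bsup>p-1+2j\<^esup> exp (- r\<^sup>2) dr = \<Gamma>(p/2 + j) / 2\<close>.  On the other hand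
  the Laplace transform of the Gaussian is a product of one-dimensional ones and equals
  \<open>\<pi>\<^bsup>p/2\<^esup> exp (|x|\<^sup>2 / 4)\<close>.  Comparing the coefficients of its even part gives the Gaussian moments
  (\<open>nn_integral_gaussian_moment\<close>), and they depend on \<open>x\<close> only through \<open>|x|\<close> because the transform
  does.
\<close>

section \<open>Gaussian moments of a linear functional\<close>

text \<open>
  Completing the square: \<open>b u - u\<^sup>2 = b\<^sup>2 / 4 - (u - b / 2)\<^sup>2\<close>, and the integral does not see the shift.
\<close>

lemma nn_integral_gaussian_exp_real:
  "(\<integral>\<^sup>+u. ennreal (exp (b * u - u\<^sup>2)) \<partial>lborel) = ennreal (sqrt pi * exp (b\<^sup>2 / 4))"
proof -
  have "has_bochner_integral lborel (\<lambda>u::real. exp (- u\<^sup>2)) (sqrt pi / 2 + sqrt pi / 2)"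
    using has_bochner_integral_even_function[OF gaussian_moment_0] by simp
  then have g: "(\<integral>\<^sup>+u. ennreal (exp (- u\<^sup>2)) \<partial>lborel) = ennreal (sqrt pi)"
    by (subst nn_integral_eq_integral) (auto simp: has_bochner_integral_iff)
  have "(\<integral>\<^sup>+u. ennreal (exp (b * u - u\<^sup>2)) \<partial>lborel)
      = (\<integral>\<^sup>+u. ennreal (exp (b * (b / 2 + u) - (b / 2 + u)\<^sup>2)) \<partial>lborel)"
    by (subst nn_integral_real_affine[where c = 1 and t = "b / 2"]) auto
  also have "\<dots> = (\<integral>\<^sup>+u. ennreal (exp (b\<^sup>2 / 4)) * ennreal (exp (- u\<^sup>2)) \<partial>lborel)"
    by (intro nn_integral_cong)
      (simp add: ennreal_mult[symmetric] exp_add[symmetric] power2_eq_square field_simps)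
  also have "\<dots> = ennreal (sqrt pi * exp (b\<^sup>2 / 4))"
    by (subst nn_integral_cmult) (auto simp: g ennreal_mult mult.commute)
  finally show ?thesis .
qed

text \<open>
  The Laplace transform of the Gaussian factorises over the coordinates, and the product depends on
  \<open>x\<close> only through \<open>x \<bullet> x\<close>.  The rotation invariance of the moments below comes from here.
\<close>

lemma nn_integral_gaussian_exp:
  fixes x :: "'a::euclidean_space"
  shows "(\<integral>\<^sup>+u. ennreal (exp (x \<bullet> u - u \<bullet> u)) \<partial>lborel)
    = ennreal (sqrt pi ^ DIM('a) * exp (x \<bullet> x / 4))"
proof -
  have e: "x \<bullet> u - u \<bullet> u = (\<Sum>b\<in>Basis. (x \<bullet> b) * (u \<bullet> b) - (u \<bullet> b)\<^sup>2)" for u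
    by (simp add: euclidean_inner[of x u] euclidean_inner[of u u] sum_subtractf power2_eq_square)
  have "(\<integral>\<^sup>+u. ennreal (exp (x \<bullet> u - u \<bullet> u)) \<partial>lborel)
     = (\<integral>\<^sup>+u. (\<Prod>b\<in>Basis. ennreal (exp ((x \<bullet> b) * (u \<bullet> b) - (u \<bullet> b)\<^sup>2))) \<partial>lborel)"
    by (simp add: e exp_sum prod_ennreal)
  also have "\<dots> = (\<Prod>b\<in>Basis. \<integral>\<^sup>+v. ennreal (exp ((x \<bullet> b) * v - v\<^sup>2)) \<partial>lborel)"
    by (rule nn_integral_lborel_prod) auto
  also have "\<dots> = (\<Prod>b\<in>(Basis::'a set). ennreal (sqrt pi * exp ((x \<bullet> b)\<^sup>2 / 4)))"
    by (simp only: nn_integral_gaussian_exp_real)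
  also have "\<dots> = ennreal (\<Prod>b\<in>(Basis::'a set). sqrt pi * exp ((x \<bullet> b)\<^sup>2 / 4))"
    by (rule prod_ennreal) auto
  also have "(\<Prod>b\<in>(Basis::'a set). sqrt pi * exp ((x \<bullet> b)\<^sup>2 / 4)) = sqrt pi ^ DIM('a) * exp (x \<bullet> x / 4)"
    by (simp add: prod.distrib exp_sum[symmetric] euclidean_inner[of x x] power2_eq_square sum_divide_distrib)
  finally show ?thesis .
qed

text \<open>
  The even part of the Laplace transform.  In contrast to \<open>exp\<close>, the power series of
  \<open>cosh\<close> has only nonnegative terms on the whole line, so that it can be integrated term by term
  by monotone convergence.
\<close>

lemma nn_integral_gaussian_cosh:
  fixes x :: "'a::euclidean_space"
  shows "(\<integral>\<^sup>+u. ennreal (cosh (x \<bullet> u) * exp (- (u \<bullet> u))) \<partial>lborel)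
    = ennreal (sqrt pi ^ DIM('a) * exp (x \<bullet> x / 4))"
proof -
  have "ennreal (cosh (x \<bullet> u) * exp (- (u \<bullet> u))) =
      ennreal (1 / 2) * ennreal (exp (x \<bullet> u - u \<bullet> u)) + ennreal (1 / 2) * ennreal (exp ((- x) \<bullet> u - u \<bullet> u))" for u
  proof -
    have "cosh (x \<bullet> u) * exp (- (u \<bullet> u)) =
        1 / 2 * exp (x \<bullet> u - u \<bullet> u) + 1 / 2 * exp ((- x) \<bullet> u - u \<bullet> u)"
      by (simp add: cosh_field_def exp_diff exp_minus field_simps)
    then show ?thesis
      by (simp only: ennreal_mult ennreal_plus exp_ge_zero zero_le_divide_1_iff zero_le_numeral
          mult_nonneg_nonneg)
  qed
  then have "(\<integral>\<^sup>+u. ennreal (cosh (x \<bullet> u) * exp (- (u \<bullet> u))) \<partial>lborel) =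
      ennreal (1 / 2) * (\<integral>\<^sup>+u. ennreal (exp (x \<bullet> u - u \<bullet> u)) \<partial>lborel) +
      ennreal (1 / 2) * (\<integral>\<^sup>+u. ennreal (exp ((- x) \<bullet> u - u \<bullet> u)) \<partial>lborel)"
    by (subst nn_integral_cmult[symmetric] nn_integral_add[symmetric]; simp)+
  also have "\<dots> = ennreal (sqrt pi ^ DIM('a) * exp (x \<bullet> x / 4))"
  proof -
    have *: "ennreal (1 / 2) * ennreal A + ennreal (1 / 2) * ennreal A = ennreal (1 / 2 * A + 1 / 2 * A)"
      if "0 \<le> A" for A
      using that by (simp only: ennreal_mult ennreal_plus zero_le_divide_1_iff zero_le_numeral
          mult_nonneg_nonneg)
    show ?thesis
      unfolding nn_integral_gaussian_exp[of x] nn_integral_gaussian_exp[of "- x"]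
      unfolding inner_minus_left inner_minus_right minus_minus
      by (subst *) simp_all
  qed
  finally show ?thesis .
qed

text \<open>
  Agreement on a half-line is enough: both series then converge everywhere, and a power series that
  vanishes at points arbitrarily close to its centre is zero.
\<close>

lemma power_series_coeffs_eq:
  fixes a b :: "nat \<Rightarrow> real"
  assumes "\<And>w. 0 \<le> w \<Longrightarrow> (\<lambda>n. a n * w ^ n) sums f w"
    and "\<And>w. 0 \<le> w \<Longrightarrow> (\<lambda>n. b n * w ^ n) sums f w"
  shows "a n = b n"
proof (rule ccontr)
  assume "a n \<noteq> b n"
  define d where "d = (\<lambda>n. a n - b n)"
  have d0: "(\<lambda>n. d n * w ^ n) sums 0" if "0 \<le> w" for w
    using sums_diff[OF assms[OF that]] by (simp add: d_def algebra_simps)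
  have "d 0 = 0"
    using d0[of 0] by simp
  with \<open>a n \<noteq> b n\<close> have "0 < n" "d n \<noteq> 0"
    by (auto simp: d_def intro: Nat.gr0I)
  have sums: "(\<lambda>n. d n * (w - 0) ^ n) sums (\<Sum>n. d n * w ^ n)" if "norm (w - 0) < 1" for w
    using powser_inside[OF sums_summable[OF d0[of 1]], of w] that by (simp add: summable_sums)
  have "(\<Sum>n. d n * 0 ^ n) = 0"
    using \<open>d 0 = 0\<close> by simp
  from powser_0_nonzero[OF zero_less_one sums this \<open>d n \<noteq> 0\<close> \<open>0 < n\<close>]
  obtain s where s: "0 < s" "\<And>z. z \<in> cball 0 s - {0} \<Longrightarrow> (\<Sum>n. d n * z ^ n) \<noteq> 0"
    by blast
  then have "(\<Sum>n. d n * s ^ n) \<noteq> 0"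
    by auto
  with sums_unique[OF d0[of s]] s show False
    by simp
qed

text \<open>
  Put \<open>\<surd>w x\<close> for \<open>x\<close> in the even part of the Laplace transform and expand in powers of \<open>w\<close>: the
  moments divided by \<open>(2 j)!\<close> are the coefficients of the power series of \<open>\<surd>\<pi>\<^sup>n exp (w (x \<bullet> x) / 4)\<close>,
  where \<open>n\<close> is the dimension.
\<close>

lemma nn_integral_gaussian_moment:
  fixes x :: "'a::euclidean_space"
  shows "(\<integral>\<^sup>+u. ennreal ((x \<bullet> u) ^ (2 * j) * exp (- (u \<bullet> u))) \<partial>lborel)
    = ennreal (sqrt pi ^ DIM('a) * (fact (2 * j) / (4 ^ j * fact j)) * (x \<bullet> x) ^ j)"
proof -
  let ?M = "\<lambda>j. \<integral>\<^sup>+u. ennreal ((x \<bullet> u) ^ (2 * j) * exp (- (u \<bullet> u))) \<partial>lborel"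
  let ?F = "\<lambda>w. sqrt pi ^ DIM('a) * exp (w * (x \<bullet> x) / 4)"
  have cosh: "(\<lambda>j. z ^ (2 * j) / fact (2 * j)) sums cosh z" for z :: real
  proof -
    have "(\<lambda>j. if even (2 * j) then z ^ (2 * j) /\<^sub>R fact (2 * j) else 0) sums cosh z"
      by (rule iffD2[OF sums_mono_reindex[of "\<lambda>j. 2 * j"] cosh_converges])
        (auto simp: strict_mono_def)
    then show ?thesis
      by (simp add: divide_inverse mult.commute)
  qed
  have series: "(\<Sum>j. ennreal (w ^ j / fact (2 * j)) * ?M j) = ennreal (?F w)" if "0 \<le> w" for w
  proof -
    have "sqrt w *\<^sub>R x \<bullet> sqrt w *\<^sub>R x = w * (x \<bullet> x)"
      using that by (simp flip: mult.assoc)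
    then have "ennreal (?F w) = (\<integral>\<^sup>+u. ennreal (cosh (sqrt w *\<^sub>R x \<bullet> u) * exp (- (u \<bullet> u))) \<partial>lborel)"
      by (simp only: nn_integral_gaussian_cosh)
    also have "\<dots> = (\<integral>\<^sup>+u. (\<Sum>j. ennreal (w ^ j / fact (2 * j)) *
        ennreal ((x \<bullet> u) ^ (2 * j) * exp (- (u \<bullet> u)))) \<partial>lborel)"
    proof (intro nn_integral_cong)
      fix u :: 'a
      have "(\<lambda>j. (sqrt w *\<^sub>R x \<bullet> u) ^ (2 * j) / fact (2 * j) * exp (- (u \<bullet> u)))
          sums (cosh (sqrt w *\<^sub>R x \<bullet> u) * exp (- (u \<bullet> u)))"
        by (intro sums_mult2 cosh)
      then have "ennreal (cosh (sqrt w *\<^sub>R x \<bullet> u) * exp (- (u \<bullet> u))) =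
        (\<Sum>j. ennreal ((sqrt w *\<^sub>R x \<bullet> u) ^ (2 * j) / fact (2 * j) * exp (- (u \<bullet> u))))"
        by (intro suminf_ennreal_eq[symmetric]) (auto simp del: inner_scaleR_left)
      also have "\<dots> = (\<Sum>j. ennreal (w ^ j / fact (2 * j)) * ennreal ((x \<bullet> u) ^ (2 * j) * exp (- (u \<bullet> u))))"
      proof (intro suminf_cong)
        fix j
        have "sqrt w ^ (2 * j) = w ^ j"
          using that by (simp only: power_mult real_sqrt_pow2)
        then have "(sqrt w *\<^sub>R x \<bullet> u) ^ (2 * j) / fact (2 * j) * exp (- (u \<bullet> u)) =
            w ^ j / fact (2 * j) * ((x \<bullet> u) ^ (2 * j) * exp (- (u \<bullet> u)))"
          by (simp add: power_mult_distrib)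
        then show "ennreal ((sqrt w *\<^sub>R x \<bullet> u) ^ (2 * j) / fact (2 * j) * exp (- (u \<bullet> u))) =
            ennreal (w ^ j / fact (2 * j)) * ennreal ((x \<bullet> u) ^ (2 * j) * exp (- (u \<bullet> u)))"
          using that by (simp only: ennreal_mult[symmetric] zero_le_even_power' mult_nonneg_nonneg
              divide_nonneg_nonneg fact_ge_zero zero_le_power exp_ge_zero power_mult zero_le_power2)
      qed
      finally show "ennreal (cosh (sqrt w *\<^sub>R x \<bullet> u) * exp (- (u \<bullet> u))) = \<dots>" .
    qed
    also have "\<dots> = (\<Sum>j. ennreal (w ^ j / fact (2 * j)) * ?M j)"
      by (subst nn_integral_suminf) (auto simp: nn_integral_cmult)
    finally show ?thesis by simp
  qed
  \<comment> \<open>Each moment is bounded, up to a factor, by the sum of the series at \<open>w = 1\<close>.\<close>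
  have fin: "?M j \<noteq> \<infinity>" for j
  proof
    assume "?M j = \<infinity>"
    then have "ennreal (1 ^ j / fact (2 * j)) * ?M j = \<infinity>"
      by (simp add: ennreal_mult_top)
    moreover have "ennreal (1 ^ j / fact (2 * j)) * ?M j \<le> (\<Sum>j. ennreal (1 ^ j / fact (2 * j)) * ?M j)"
      using sum_le_suminf[of "\<lambda>j. ennreal (1 ^ j / fact (2 * j)) * ?M j" "{j}"] by simp
    ultimately show False
      using series[of 1] by (simp add: top_unique)
  qed
  define m where "m j = enn2real (?M j)" for j
  have m: "0 \<le> m j" "?M j = ennreal (m j)" for j
    using fin[of j] by (simp_all add: m_def less_top)
  define a b where "a n = m n / fact (2 * n)" and "b n = sqrt pi ^ DIM('a) * (x \<bullet> x / 4) ^ n / fact n" for n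
  have sums_a: "(\<lambda>n. a n * w ^ n) sums ?F w" if w: "0 \<le> w" for w
  proof -
    have eq: "(\<Sum>n. ennreal (a n * w ^ n)) = ennreal (?F w)"
      unfolding a_def using series[OF w] w
      by (simp only: m ennreal_mult[symmetric] zero_le_power divide_nonneg_nonneg fact_ge_zero)
        (simp add: mult.commute)
    have "(\<lambda>n. ennreal (a n * w ^ n)) sums ennreal (?F w)"
      unfolding eq[symmetric] by (rule summable_sums[OF summableI])
    then show ?thesis
      by (rule iffD1[OF sums_ennreal, rotated 2]) (use w m(1) in \<open>auto simp: a_def\<close>)
  qed
  have sums_b: "(\<lambda>n. b n * w ^ n) sums ?F w" for w
  proof -
    have "(\<lambda>n. sqrt pi ^ DIM('a) * ((w * (x \<bullet> x) / 4) ^ n /\<^sub>R fact n)) sums ?F w"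
      by (intro sums_mult exp_converges)
    also have "(\<lambda>n. sqrt pi ^ DIM('a) * ((w * (x \<bullet> x) / 4) ^ n /\<^sub>R fact n)) = (\<lambda>n. b n * w ^ n)"
      by (simp add: b_def power_mult_distrib power_divide divide_simps mult_ac)
    finally show ?thesis .
  qed
  have "a j = b j"
    by (rule power_series_coeffs_eq[of a ?F b]) (use sums_a sums_b in auto)
  then have "m j = b j * fact (2 * j)"
    by (simp only: a_def divide_eq_eq[of "m j"] fact_nonzero if_False not_False_eq_True if_True)
  also have "\<dots> = sqrt pi ^ DIM('a) * (fact (2 * j) / (4 ^ j * fact j)) * (x \<bullet> x) ^ j"
    by (simp add: b_def power_divide)
  finally show ?thesis
    by (simp only: m)
qed

text \<open>
  Both sides start at \<open>\<surd>\<pi>\<close> and gain the factor \<open>j + 1/2\<close> in each step; the left-hand side is the form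
  in which comparing power series yields the Gaussian moments.
\<close>

lemma Gamma_nat_plus_half:
  "sqrt pi * fact (2 * j) / (4 ^ j * fact j) = Gamma (real j + 1 / 2)"
proof (induction j)
  case 0
  show ?case by (simp add: Gamma_one_half_real)
next
  case (Suc j)
  have "real j + 1 / 2 \<notin> \<int>\<^sub>\<le>\<^sub>0"
    by (meson add_nonneg_pos nonpos_Ints_nonpos not_le of_nat_0_le_iff zero_less_divide_1_iff zero_less_numeral)
  then have "Gamma (real j + 1 / 2 + 1) = (real j + 1 / 2) * Gamma (real j + 1 / 2)"
    by (rule Gamma_plus1)
  also have "real j + 1 / 2 + 1 = real (Suc j) + 1 / 2"
    by simp
  finally have G: "Gamma (real (Suc j) + 1 / 2) = (real j + 1 / 2) * Gamma (real j + 1 / 2)" .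
  have "fact (2 * Suc j) = (4 * (real j + 1) * (real j + 1 / 2)) * fact (2 * j)"
    by (simp add: algebra_simps)
  moreover have "fact (Suc j) = (real j + 1) * fact j"
    by (simp add: algebra_simps)
  moreover have "real j + 1 \<noteq> 0" by linarith
  moreover have "c * (4 * t * h * F) / (4 * P * (t * Q)) = h * (c * F / (P * Q))"
    if "t \<noteq> 0" for c t h F P Q :: real
    using that by simp
  ultimately show ?case
    unfolding G Suc.IH[symmetric] by (simp only: power_Suc)
qed

text \<open>
  This is Euler's integral in the variable \<open>r\<^sup>2\<close>.  The half-line moments of the Gaussian are given by
  factorials, in one form for even and in another for odd order, and \<open>\<Gamma>\<close> unites the two.
\<close>

lemma nn_integral_gaussian_radial:
  "(\<integral>\<^sup>+r. ennreal (indicator {0..} r * (exp (- r\<^sup>2) * r ^ n)) \<partial>lborel) = ennreal (Gamma ((real n + 1) / 2) / 2)"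
proof -
  have *: "(\<integral>\<^sup>+r. ennreal (indicator {0..} r * (exp (- r\<^sup>2) * r ^ n)) \<partial>lborel) = ennreal I"
    if "has_bochner_integral lborel (\<lambda>r::real. indicator {0..} r *\<^sub>R (exp (- r\<^sup>2) * r ^ n)) I" for I
    using that by (subst nn_integral_eq_integral) (auto simp: has_bochner_integral_iff indicator_def)
  show ?thesis
  proof (cases "even n")
    case True
    then obtain k where n: "n = 2 * k" by auto
    show ?thesis
      using *[OF gaussian_moment_even_pos[of k, folded n]] Gamma_nat_plus_half[of k]
      by (simp add: n power_mult add_divide_distrib)
  next
    case False
    then obtain k where n: "n = 2 * k + 1" by (auto elim: oddE)
    have "Gamma (real k + 1) = fact k" using Gamma_fact[of k, where 'a = real] by (simp add: add.commute)
    then show ?thesis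
      using *[OF gaussian_moment_odd_pos[of k, folded n]]
      by (simp add: n add_divide_distrib add.commute)
  qed
qed

section \<open>Integration over the unit sphere\<close>

text \<open>
  The surface measure in terms of Lebesgue measure: the integrand is extended to the ball so as to be
  constant along rays.  The origin, where normalisation gives the value \<open>0\<close>, is a null set.
\<close>

lemma nn_integral_sphere_measure:
  fixes f :: "'a::euclidean_space \<Rightarrow> ennreal"
  assumes [measurable]: "f \<in> borel_measurable borel"
  shows "(\<integral>\<^sup>+t. f t \<partial>sphere_measure)
    = of_nat DIM('a) * (\<integral>\<^sup>+u. f (u /\<^sub>R norm u) * indicator (cball 0 1) u \<partial>lborel)"
proof -
  have f: "f \<in> borel_measurable (restrict_space borel (sphere 0 1))"
    by (intro measurable_restrict_space1) simp
  have "(\<integral>\<^sup>+t. f t \<partial>sphere_measure) = of_nat DIM('a) *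
    (\<integral>\<^sup>+u. f (u /\<^sub>R norm u) * indicator (cball 0 1 - {0}) u \<partial>lborel)"
  proof -
    have "(\<integral>\<^sup>+t. f t \<partial>sphere_measure) = of_nat DIM('a) *
        (\<integral>\<^sup>+t. f t \<partial>distr (restrict_space lborel (cball 0 1 - {0})) (restrict_space borel (sphere 0 1))
          (\<lambda>x. x /\<^sub>R norm x))"
      unfolding sphere_measure_def by (rule nn_integral_scale_measure) (use f in simp)
    also have "(\<integral>\<^sup>+t. f t \<partial>distr (restrict_space lborel (cball 0 1 - {0})) (restrict_space borel (sphere 0 1))
          (\<lambda>x. x /\<^sub>R norm x))
        = (\<integral>\<^sup>+u. f (u /\<^sub>R norm u) \<partial>restrict_space lborel (cball 0 1 - {0}))"
      using f by (intro nn_integral_distr[OF measurable_normalize]) simp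
    also have "\<dots> = (\<integral>\<^sup>+u. f (u /\<^sub>R norm u) * indicator (cball 0 1 - {0}) u \<partial>lborel)"
      by (rule nn_integral_restrict_space) simp
    finally show ?thesis .
  qed
  also have "(\<integral>\<^sup>+u. f (u /\<^sub>R norm u) * indicator (cball 0 1 - {0}) u \<partial>lborel)
    = (\<integral>\<^sup>+u. f (u /\<^sub>R norm u) * indicator (cball 0 1) u \<partial>lborel)"
    by (intro nn_integral_cong_AE eventually_mono[OF AE_lborel_singleton[of 0]])
      (simp split: split_indicator)
  finally show ?thesis .
qed

lemma nn_integral_lborel_scaleR:
  fixes f :: "'a::euclidean_space \<Rightarrow> ennreal"
  assumes [measurable]: "f \<in> borel_measurable borel" and "c \<noteq> 0"
  shows "(\<integral>\<^sup>+u. f u \<partial>lborel) = ennreal (\<bar>c\<bar> ^ DIM('a)) * (\<integral>\<^sup>+u. f (c *\<^sub>R u) \<partial>lborel)"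
  by (subst lborel_affine[OF \<open>c \<noteq> 0\<close>, of 0])
    (simp add: nn_integral_density nn_integral_distr nn_integral_cmult ennreal_power)

text \<open>
  In dimension \<open>n\<close>, push the measure with density \<open>f (u / |u|)\<close> forward along the norm.  By
  homogeneity its mass on the ball of radius \<open>r\<close> is \<open>r\<^sup>n\<close> times that on the unit ball, which is \<open>1 / n\<close> times the integral of
  \<open>f\<close> over the sphere.  Hence it has density a multiple of \<open>r\<^sup>n\<^sup>-\<^sup>1\<close>, since measures that are finite
  and equal on all half-lines \<open>{..r}\<close> coincide; this is where the finiteness assumption enters.
\<close>

lemma nn_integral_polar:
  fixes f :: "'a::euclidean_space \<Rightarrow> ennreal" and g :: "real \<Rightarrow> ennreal"
  assumes f [measurable]: "f \<in> borel_measurable borel" and g [measurable]: "g \<in> borel_measurable borel"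
    and fin: "(\<integral>\<^sup>+t. f t \<partial>sphere_measure) < \<infinity>"
  shows "(\<integral>\<^sup>+u. f (u /\<^sub>R norm u) * g (norm u) \<partial>lborel)
    = (\<integral>\<^sup>+t. f t \<partial>sphere_measure) *
      (\<integral>\<^sup>+r. indicator {0..} r * ennreal (r ^ (DIM('a) - 1)) * g r \<partial>lborel)"
proof -
  define I where "I = (\<integral>\<^sup>+t. f t \<partial>sphere_measure)"
  define M where "M = distr (density lborel (\<lambda>u::'a. f (u /\<^sub>R norm u))) borel norm"
  define N where "N = density lborel (\<lambda>r. I * (indicator {0..} r * ennreal (r ^ (DIM('a) - 1))))"
  have N: "emeasure N {..r} = I * ennreal (max 0 r ^ DIM('a) / DIM('a))" for r
  proof -
    have "emeasure N {..r} = (\<integral>\<^sup>+s. I * (ennreal (s ^ (DIM('a) - 1)) * indicator {0..max 0 r} s) \<partial>lborel)"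
      unfolding N_def
      by (subst emeasure_density, simp, simp, intro nn_integral_cong_AE eventually_mono[OF AE_lborel_singleton[of 0]])
        (auto simp: indicator_def)
    also have "\<dots> = I * (\<integral>\<^sup>+s. ennreal (s ^ (DIM('a) - 1)) * indicator {0..max 0 r} s \<partial>lborel)"
      by (rule nn_integral_cmult) simp
    also have "(\<integral>\<^sup>+s. ennreal (s ^ (DIM('a) - 1)) * indicator {0..max 0 r} s \<partial>lborel)
        = ennreal (max 0 r ^ DIM('a) / DIM('a) - 0 ^ DIM('a) / DIM('a))"
      by (rule nn_integral_FTC_Icc) (auto intro!: derivative_eq_intros simp: field_simps)
    finally show ?thesis by (simp add: zero_power)
  qed
  have M: "emeasure M {..r} = I * ennreal (max 0 r ^ DIM('a) / DIM('a))" for r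
  proof -
    have "norm -` {..r} = cball (0::'a) r"
      by auto
    then have *: "emeasure M {..r} = (\<integral>\<^sup>+u. f (u /\<^sub>R norm u) * indicator (cball 0 r) u \<partial>lborel)"
      unfolding M_def by (subst emeasure_distr) (simp_all add: emeasure_density)
    show ?thesis
    proof (cases "0 < r")
      case True
      have hom: "f ((r *\<^sub>R u) /\<^sub>R norm (r *\<^sub>R u)) * indicator (cball 0 r) (r *\<^sub>R u) =
          f (u /\<^sub>R norm u) * indicator (cball 0 1) u" for u
      proof -
        have "(r *\<^sub>R u) /\<^sub>R norm (r *\<^sub>R u) = u /\<^sub>R norm u"
          using True by (simp add: field_simps)
        moreover have "r *\<^sub>R u \<in> cball 0 r \<longleftrightarrow> u \<in> cball 0 1"
          using True by simp
        ultimately show ?thesis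
          by (simp only: indicator_def)
      qed
      have "emeasure M {..r} = ennreal (r ^ DIM('a)) *
          (\<integral>\<^sup>+u. f (u /\<^sub>R norm u) * indicator (cball 0 1) u \<partial>lborel)"
      proof -
        have meas: "(\<lambda>u. f (u /\<^sub>R norm u) * indicator (cball 0 r) u) \<in> borel_measurable borel"
          by (intro borel_measurable_times_ennreal borel_measurable_indicator) simp_all
        show ?thesis
          unfolding * nn_integral_lborel_scaleR[OF meas less_imp_neq[OF True, symmetric]]
          using True by (simp only: hom abs_of_pos)
      qed
      also have "ennreal (r ^ DIM('a)) = ennreal (r ^ DIM('a) / DIM('a)) * of_nat DIM('a)"
        using True by (simp add: ennreal_of_nat_eq_real_of_nat flip: ennreal_mult)
      also have "ennreal (r ^ DIM('a) / DIM('a)) * of_nat DIM('a) *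
          (\<integral>\<^sup>+u. f (u /\<^sub>R norm u) * indicator (cball 0 1) u \<partial>lborel)
        = I * ennreal (max 0 r ^ DIM('a) / DIM('a))"
        using True by (simp add: I_def nn_integral_sphere_measure mult_ac)
      finally show ?thesis .
    next
      case False
      have "u \<notin> cball 0 r" if "u \<noteq> 0" for u :: 'a
        using False that zero_less_norm_iff[of u] by (simp del: zero_less_norm_iff)
      then have "(\<integral>\<^sup>+u. f (u /\<^sub>R norm u) * indicator (cball 0 r) u \<partial>lborel) = (\<integral>\<^sup>+u. 0 \<partial>(lborel :: 'a measure))"
        by (intro nn_integral_cong_AE eventually_mono[OF AE_lborel_singleton[of 0]]) simp
      with False * show ?thesis by (simp add: zero_power)
    qed
  qed
  have "M = N"
  proof (rule measure_eqI_generator_eq)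
    show "Int_stable (range (\<lambda>r::real. {..r}))"
      by (auto simp: Int_stable_def)
    show "sets M = sigma_sets UNIV (range (\<lambda>r::real. {..r}))"
      "sets N = sigma_sets UNIV (range (\<lambda>r::real. {..r}))"
      by (simp_all add: M_def N_def borel_eq_atMost)
    show "emeasure M X = emeasure N X" if "X \<in> range (\<lambda>r::real. {..r})" for X
      using that by (auto simp: M N)
    show "range (\<lambda>n. {..real n}) \<subseteq> range (\<lambda>r::real. {..r})"
      by auto
    show "(\<Union>n. {..real n}) = UNIV"
      using real_arch_simple by auto
    show "emeasure M {..real n} \<noteq> \<infinity>" for n
      using fin by (simp add: M I_def ennreal_mult_eq_top_iff less_top)
  qed auto
  have "(\<integral>\<^sup>+u. f (u /\<^sub>R norm u) * g (norm u) \<partial>lborel) = (\<integral>\<^sup>+r. g r \<partial>M)"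
    by (simp add: M_def nn_integral_distr nn_integral_density)
  also have "\<dots> = (\<integral>\<^sup>+r. I * (indicator {0..} r * ennreal (r ^ (DIM('a) - 1)) * g r) \<partial>lborel)"
    unfolding \<open>M = N\<close> by (simp add: N_def nn_integral_density mult.assoc)
  also have "\<dots> = I * (\<integral>\<^sup>+r. indicator {0..} r * ennreal (r ^ (DIM('a) - 1)) * g r \<partial>lborel)"
    by (rule nn_integral_cmult) simp
  finally show ?thesis by (simp add: I_def)
qed

lemma finite_measure_sphere_measure: "finite_measure (sphere_measure :: 'a::euclidean_space measure)"
  by (rule finite_measureI) (simp add: emeasure_sphere_measure_sphere)

lemma borel_measurable_sphere_measure:
  assumes "continuous_on UNIV f"
  shows "f \<in> borel_measurable sphere_measure"
  using borel_measurable_continuous_onI[OF assms]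
  by (simp add: measurable_cong_sets[OF sets_sphere_measure refl] measurable_restrict_space1)

lemma integrable_sphere_measure:
  fixes f :: "'a::euclidean_space \<Rightarrow> 'b::{banach, second_countable_topology}"
  assumes "continuous_on UNIV f"
  shows "integrable sphere_measure f"
proof -
  have "compact (f ` sphere 0 1)"
    by (intro compact_continuous_image continuous_on_subset[OF assms]) auto
  then obtain B where "\<forall>t\<in>sphere 0 1. norm (f t) \<le> B"
    by (auto simp: bounded_iff dest!: compact_imp_bounded)
  then show ?thesis
    by (intro finite_measure.integrable_const_bound[OF finite_measure_sphere_measure, of _ B]
        borel_measurable_sphere_measure assms) auto
qed

text \<open>
  Reflection preserves Lebesgue measure and the ball.  The positive and the negative part are
  compared separately, as the formula for the surface measure is one for nonnegative functions.
\<close>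

lemma integral_sphere_measure_uminus:
  fixes f :: "'a::euclidean_space \<Rightarrow> real"
  assumes "continuous_on UNIV f"
  shows "(LINT t|sphere_measure. f (- t)) = (LINT t|sphere_measure. f t)"
proof -
  have nn: "(\<integral>\<^sup>+t. h (- t) \<partial>sphere_measure) = (\<integral>\<^sup>+t. h t \<partial>sphere_measure)"
    if [measurable]: "h \<in> borel_measurable borel" for h :: "'a \<Rightarrow> ennreal"
    by (simp add: nn_integral_sphere_measure)
      (subst nn_integral_lborel_scaleR[of _ "- 1"], auto simp: indicator_def intro!: nn_integral_cong arg_cong2[where f = "(*)"])
  have [measurable]: "f \<in> borel_measurable borel"
    by (rule borel_measurable_continuous_onI[OF assms])
  have "continuous_on UNIV (\<lambda>t. f (- t))"
    using assms by (auto intro!: continuous_intros continuous_on_compose2[OF assms])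
  then show ?thesis
    using nn[of "\<lambda>t. ennreal (f t)"] nn[of "\<lambda>t. ennreal (- f t)"] assms
    by (simp add: real_lebesgue_integral_def integrable_sphere_measure)
qed

section \<open>Moments of the unit sphere\<close>

lemma integral_sphere_measure_odd_power:
  fixes x :: "'a::euclidean_space"
  assumes "odd m"
  shows "(LINT t|sphere_measure. (x \<bullet> t) ^ m) = 0"
proof -
  have "continuous_on UNIV (\<lambda>t. (x \<bullet> t) ^ m)" by (intro continuous_intros)
  from integral_sphere_measure_uminus[OF this] assms show ?thesis
    by simp
qed

text \<open>
  Compute \<open>\<integral> (x \<bullet> u)\<^sup>2\<^sup>j exp (- |u|\<^sup>2) du\<close> in two ways: as a Gaussian moment, and in polar
  coordinates, where the integrand splits into \<open>(x \<bullet> t)\<^sup>2\<^sup>j\<close> on the sphere and a radial factor.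
\<close>

lemma integral_sphere_measure_even_power:
  fixes x :: "'a::euclidean_space"
  shows "(LINT t|sphere_measure. (x \<bullet> t) ^ (2 * j))
    = 2 * sqrt pi ^ (DIM('a) - 1) * Gamma (real j + 1 / 2) / Gamma (DIM('a) / 2 + real j) * (x \<bullet> x) ^ j"
proof -
  let ?J = "LINT t|sphere_measure. (x \<bullet> t) ^ (2 * j)"
  let ?G = "Gamma (DIM('a) / 2 + real j)"
  have int: "integrable sphere_measure (\<lambda>t. (x \<bullet> t) ^ (2 * j))"
    by (intro integrable_sphere_measure continuous_intros)
  then have J: "(\<integral>\<^sup>+t. ennreal ((x \<bullet> t) ^ (2 * j)) \<partial>sphere_measure) = ennreal ?J"
    by (intro nn_integral_eq_integral) auto
  have "0 \<le> ?J" by (intro Bochner_Integration.integral_nonneg) auto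
  have "0 < ?G" by (intro Gamma_real_pos add_pos_nonneg) auto
  \<comment> \<open>Polar form of the integrand; at \<open>u = 0\<close> it holds because \<open>u /\<^sub>R norm u\<close> is \<open>0\<close> there.\<close>
  have hom: "(x \<bullet> u) ^ (2 * j) * exp (- (u \<bullet> u)) =
      (x \<bullet> (u /\<^sub>R norm u)) ^ (2 * j) * (norm u ^ (2 * j) * exp (- (norm u)\<^sup>2))" for u
  proof -
    have "x \<bullet> u = (x \<bullet> (u /\<^sub>R norm u)) * norm u"
      by (cases "u = 0") auto
    then have "(x \<bullet> u) ^ (2 * j) = (x \<bullet> (u /\<^sub>R norm u)) ^ (2 * j) * norm u ^ (2 * j)"
      by (metis power_mult_distrib)
    then show ?thesis
      by (simp only: power2_norm_eq_inner mult.assoc)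
  qed
  have "ennreal (sqrt pi ^ DIM('a) * (fact (2 * j) / (4 ^ j * fact j)) * (x \<bullet> x) ^ j)
    = (\<integral>\<^sup>+u. ennreal ((x \<bullet> u) ^ (2 * j) * exp (- (u \<bullet> u))) \<partial>lborel)"
    by (simp only: nn_integral_gaussian_moment)
  also have "\<dots> = (\<integral>\<^sup>+u. ennreal ((x \<bullet> (u /\<^sub>R norm u)) ^ (2 * j)) *
      ennreal (norm u ^ (2 * j) * exp (- (norm u)\<^sup>2)) \<partial>lborel)"
    unfolding hom by (simp add: ennreal_mult)
  also have "\<dots> = ennreal ?J * (\<integral>\<^sup>+r. indicator {0..} r * ennreal (r ^ (DIM('a) - 1)) *
      ennreal (r ^ (2 * j) * exp (- r\<^sup>2)) \<partial>lborel)"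
    by (subst nn_integral_polar[where f = "\<lambda>t. ennreal ((x \<bullet> t) ^ (2 * j))" and g = "\<lambda>r. ennreal (r ^ (2 * j) * exp (- r\<^sup>2))"])
      (simp_all add: J)
  also have "(\<integral>\<^sup>+r. indicator {0..} r * ennreal (r ^ (DIM('a) - 1)) *
      ennreal (r ^ (2 * j) * exp (- r\<^sup>2)) \<partial>lborel)
    = (\<integral>\<^sup>+r. ennreal (indicator {0..} r * (exp (- r\<^sup>2) * (r ^ (DIM('a) - 1) * r ^ (2 * j)))) \<partial>lborel)"
    by (intro nn_integral_cong) (auto simp: indicator_def ennreal_mult[symmetric] mult_ac)
  also have "\<dots> = ennreal (?G / 2)"
    unfolding power_add[symmetric] nn_integral_gaussian_radial
    using DIM_positive[where 'a = 'a] by (simp add: of_nat_diff Suc_leI add_divide_distrib)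
  also have "ennreal ?J * ennreal (?G / 2) = ennreal (?J * (?G / 2))"
    by (rule ennreal_mult[symmetric]) (use \<open>0 \<le> ?J\<close> \<open>0 < ?G\<close> in simp_all)
  finally have "sqrt pi ^ DIM('a) * (fact (2 * j) / (4 ^ j * fact j)) * (x \<bullet> x) ^ j = ?J * (?G / 2)"
    using \<open>0 \<le> ?J\<close> \<open>0 < ?G\<close> by (subst (asm) ennreal_inj) auto
  moreover have "sqrt pi ^ DIM('a) * (fact (2 * j) / (4 ^ j * fact j)) =
      sqrt pi ^ (DIM('a) - 1) * (sqrt pi * fact (2 * j) / (4 ^ j * fact j))"
    using power_minus_mult[OF DIM_positive[where 'a = 'a], of "sqrt pi"]
    by (simp flip: mult.assoc)
  ultimately have "?J * (?G / 2) = sqrt pi ^ (DIM('a) - 1) * Gamma (real j + 1 / 2) * (x \<bullet> x) ^ j"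
    by (simp only: Gamma_nat_plus_half)
  then show ?thesis
    using \<open>0 < ?G\<close> by (simp add: eq_divide_eq mult_ac)
qed

text \<open>
  Binomial theorem under the integral sign; the odd powers of \<open>x \<bullet> t\<close> integrate to zero.
\<close>

lemma integral_sphere_binomial:
  fixes x :: "'a::euclidean_space" and w :: complex
  shows "(LINT t|sphere_measure. (of_real (x \<bullet> t) + w) ^ k)
    = (\<Sum>j = 0..k div 2. of_nat (k choose (2 * j)) *
        of_real (LINT t|sphere_measure. (x \<bullet> t) ^ (2 * j)) * w ^ (k - 2 * j))"
proof -
  let ?I = "\<lambda>m. LINT t|sphere_measure. (x \<bullet> t) ^ m"
  let ?T = "\<lambda>m. of_nat (k choose m) * of_real (?I m) * w ^ (k - m) :: complex"
  have int: "integrable sphere_measure (\<lambda>t. complex_of_real ((x \<bullet> t) ^ m))" for m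
    by (intro integrable_sphere_measure continuous_intros)
  have "(LINT t|sphere_measure. (of_real (x \<bullet> t) + w) ^ k) =
      (LINT t|sphere_measure. (\<Sum>m\<le>k. (of_nat (k choose m) * complex_of_real ((x \<bullet> t) ^ m)) * w ^ (k - m)))"
    by (simp add: binomial_ring)
  also have "\<dots> = (\<Sum>m\<le>k. (LINT t|sphere_measure. (of_nat (k choose m) * complex_of_real ((x \<bullet> t) ^ m)) * w ^ (k - m)))"
    by (intro Bochner_Integration.integral_sum integrable_mult_left integrable_mult_right int)
  also have "\<dots> = (\<Sum>m\<le>k. ?T m)"
    by (intro sum.cong refl)
      (simp only: integral_mult_left_zero integral_mult_right_zero integral_complex_of_real)
  also have "\<dots> = (\<Sum>m\<in>(\<lambda>j. 2 * j) ` {0..k div 2}. ?T m)"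
  proof (rule sum.mono_neutral_right)
    show "\<forall>m\<in>{..k} - (\<lambda>j. 2 * j) ` {0..k div 2}. ?T m = 0"
    proof
      fix m assume m: "m \<in> {..k} - (\<lambda>j. 2 * j) ` {0..k div 2}"
      have "odd m"
      proof
        assume "even m"
        then have "m = 2 * (m div 2)" "m div 2 \<in> {0..k div 2}"
          using m by (auto intro: div_le_mono)
        with m show False by blast
      qed
      then show "?T m = 0"
        by (simp add: integral_sphere_measure_odd_power)
    qed
  qed auto
  also have "\<dots> = (\<Sum>j = 0..k div 2. ?T (2 * j))"
    by (subst sum.reindex) (auto simp: inj_on_def)
  finally show ?thesis .
qed

section \<open>Even powers of a vector in the Clifford algebra\<close>

lemma clifford_of_complex_sum:
  "(clifford_of_complex (sum f I) :: 'n::{finite,linorder} clifford) = (\<Sum>i\<in>I. clifford_of_complex (f i))"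
  by (rule clifford_eqI) simp

lemma clifford_of_complex_power:
  "(clifford_of_complex (c ^ n) :: 'n::{finite,linorder} clifford) = clifford_of_complex c ^ n"
  by (induction n) (simp_all add: clifford_of_complex_hom)

text \<open>
  Adding to the double sum its transpose leaves only the anticommutators of the generators, so that
  twice the square is \<open>-2 (x \<bullet> x)\<close>; the factor \<open>2\<close> is cancelled coefficientwise.
\<close>

lemma clifford_vector_square:
  fixes x :: "real ^ 'p::{finite,linorder}"
  shows "(clifford_vector x ^ 2 :: ('p + 'q::{finite,linorder}) clifford)
    = clifford_of_complex (of_real (- (x \<bullet> x)))"
proof -
  let ?c = "clifford_of_complex :: complex \<Rightarrow> ('p + 'q) clifford"
  let ?e = "\<lambda>i. gen (Inl i) :: ('p + 'q) clifford"
  let ?v = "clifford_vector x :: ('p + 'q) clifford"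
  let ?t = "\<lambda>i j. ?c (of_real (x $ i)) * ?e i * (?c (of_real (x $ j)) * ?e j)"
  have t: "?t i j = ?c (of_real (x $ i * x $ j)) * (?e i * ?e j)" for i j
  proof -
    have "?t i j = ?c (of_real (x $ i)) * (?e i * ?c (of_real (x $ j))) * ?e j"
      by (simp only: mult.assoc)
    also have "\<dots> = ?c (of_real (x $ i * x $ j)) * (?e i * ?e j)"
      by (simp only: clifford_of_complex_central[of "?e i"] of_real_mult clifford_of_complex_hom mult.assoc)
    finally show ?thesis .
  qed
  have sq: "?v ^ 2 = (\<Sum>i\<in>UNIV. \<Sum>j\<in>UNIV. ?t i j)"
    by (simp only: power2_eq_square clifford_vector_def sum_product)
  have "?v ^ 2 + ?v ^ 2 = (\<Sum>i\<in>UNIV. \<Sum>j\<in>UNIV. ?t i j) + (\<Sum>i\<in>UNIV. \<Sum>j\<in>UNIV. ?t j i)"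
    unfolding sq by (subst (3) sum.swap) (rule refl)
  also have "\<dots> = (\<Sum>i\<in>UNIV. \<Sum>j\<in>UNIV. ?c (of_real (x $ i * x $ j)) * (?e i * ?e j + ?e j * ?e i))"
  proof -
    have "?t i j + ?t j i = ?c (of_real (x $ i * x $ j)) * (?e i * ?e j + ?e j * ?e i)" for i j
      unfolding t distrib_left by (simp only: mult.commute[of "x $ j" "x $ i"])
    then show ?thesis
      by (simp only: sum.distrib[symmetric])
  qed
  also have "\<dots> = (\<Sum>i\<in>UNIV. \<Sum>j\<in>UNIV. if i = j then ?c (of_real (x $ i * x $ j)) * - 2 else 0)"
    by (intro sum.cong refl) (auto simp: gen_anticommute)
  also have "\<dots> = (\<Sum>i\<in>UNIV. ?c (of_real (x $ i * x $ i)) * - 2)"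
    by simp
  also have "\<dots> = ?c (of_real (x \<bullet> x)) * - 2"
    by (simp only: sum_distrib_right[symmetric] clifford_of_complex_sum[symmetric] inner_vec_def
        inner_real_def of_real_sum)
  finally have sum: "?v ^ 2 + ?v ^ 2 = ?c (of_real (x \<bullet> x)) * - 2" .
  have "(- 2 :: ('p + 'q) clifford) = - (1 + 1)"
    by simp
  then have two: "coeff (- 2 :: ('p + 'q) clifford) A = (if A = {} then - 2 else 0)" for A
    by (simp only: one_clifford_def coeff_add_group coeff_clifford_of_complex) simp
  have "coeff (?v ^ 2) A = coeff (?c (of_real (- (x \<bullet> x)))) A" for A
  proof -
    have "coeff (?v ^ 2) A + coeff (?v ^ 2) A = of_real (x \<bullet> x) * (if A = {} then - 2 else 0)"
      using arg_cong[OF sum, of "\<lambda>a. coeff a A"]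
      by (simp only: coeff_add_group(2) coeff_clifford_of_complex_mult two)
    then have "2 * coeff (?v ^ 2) A = 2 * coeff (?c (of_real (- (x \<bullet> x)))) A"
      unfolding mult_2 by (cases "A = {}") simp_all
    then show ?thesis
      by (simp only: mult_cancel_left) simp
  qed
  then show ?thesis
    by (rule clifford_eqI)
qed

lemma clifford_vector_even_power:
  fixes x :: "real ^ 'p::{finite,linorder}"
  shows "(clifford_vector x ^ (2 * j) :: ('p + 'q::{finite,linorder}) clifford)
    = clifford_of_complex (of_real ((- (x \<bullet> x)) ^ j))"
  by (simp only: power_mult clifford_vector_square of_real_power clifford_of_complex_power)

section \<open>The expansion of the spherical integral\<close>

theorem proposition5p3:
  fixes k :: nat
    and x :: "real ^ 'p::{finite,linorder}"
    and y s :: "real ^ 'q::{finite,linorder}"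
  assumes "CARD('p) = CARD('r::finite) + 1"
    and "s \<in> sphere 0 1"
  shows "(clifford_of_complex
            (LINT t|sphere_measure. (of_real (x \<bullet> t) + \<i> * of_real (y \<bullet> s)) ^ k)
          :: ('p + 'q) clifford)
       = clifford_of_complex (of_real (unit_sphere_area TYPE(real ^ 'r))) *
         (\<Sum>j = 0..k div 2. clifford_vector x ^ (2 * j) *
            clifford_of_complex (b_coeff CARD('p) k j (y \<bullet> s)))"
proof -
  define w where "w = \<i> * complex_of_real (y \<bullet> s)"
  let ?A = "unit_sphere_area TYPE(real ^ 'r)"
  \<comment> \<open>The Gamma factor of \<open>b_coeff\<close> cancels the denominator of the area of the lower sphere.\<close>
  have area: "?A * Gamma ((real CARD('p) - 1) / 2) = 2 * sqrt pi ^ (CARD('p) - 1)"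
  proof -
    have "Gamma (real CARD('r) / 2) \<noteq> 0"
      by (intro less_imp_neq[symmetric] Gamma_real_pos) simp
    moreover have "sqrt pi ^ CARD('r) = pi powr (CARD('r) / 2)"
      by (simp add: powr_half_sqrt[symmetric] powr_realpow[symmetric] powr_powr)
    ultimately show ?thesis
      using assms(1) by (simp add: unit_sphere_area_eq)
  qed
  have term_eq: "of_nat (k choose (2 * j)) * of_real (LINT t|sphere_measure. (x \<bullet> t) ^ (2 * j)) * w ^ (k - 2 * j)
    = complex_of_real ?A * (of_real ((- (x \<bullet> x)) ^ j) * b_coeff CARD('p) k j (y \<bullet> s))" for j
  proof -
    have "(- 1) ^ j * (- (x \<bullet> x)) ^ j = (x \<bullet> x) ^ j"
      by (simp flip: power_mult_distrib)
    then have "?A * ((- (x \<bullet> x)) ^ j * ((- 1) ^ j * (Gamma ((real CARD('p) - 1) / 2) *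
        Gamma (real j + 1 / 2) / Gamma (real CARD('p) / 2 + real j)))) =
      (?A * Gamma ((real CARD('p) - 1) / 2)) * Gamma (real j + 1 / 2) /
        Gamma (real CARD('p) / 2 + real j) * (x \<bullet> x) ^ j"
      by (simp add: mult_ac)
    also have "\<dots> = (LINT t|sphere_measure. (x \<bullet> t) ^ (2 * j))"
      unfolding area integral_sphere_measure_even_power by simp
    finally have "(LINT t|sphere_measure. (x \<bullet> t) ^ (2 * j)) =
      ?A * ((- (x \<bullet> x)) ^ j * ((- 1) ^ j * (Gamma ((real CARD('p) - 1) / 2) *
        Gamma (real j + 1 / 2) / Gamma (real CARD('p) / 2 + real j))))" ..
    then show ?thesis
      by (simp add: b_coeff_def w_def mult_ac)
  qed
  have "(clifford_of_complex (LINT t|sphere_measure. (of_real (x \<bullet> t) + w) ^ k) :: ('p + 'q) clifford)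
    = clifford_of_complex (of_real ?A * (\<Sum>j = 0..k div 2. of_real ((- (x \<bullet> x)) ^ j) * b_coeff CARD('p) k j (y \<bullet> s)))"
    by (simp only: integral_sphere_binomial term_eq sum_distrib_left)
  then show ?thesis
    by (simp only: w_def clifford_vector_even_power clifford_of_complex_hom clifford_of_complex_sum)
qed

end
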